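(* Let $(X,d,\mu)$ be a coarse median space. Then $X$ has rank at most $1$ if and only if there exists a constant $\lambda$ such that for all $a,b,x\in X$ with $x\in[a,b]$, $$[a,b]\subseteq\mathcal N_\lambda([a,x])\cup\mathcal N_\lambda([x,b]).$$
   Context: Write $x\sim_s y$ if $d(x,y)\leqslant s$. A coarse median space is a triple $(X,d,\mu)$ with $(X,d)$ a metric space and $\mu\colon X^3\to X$ satisfying: (M1) $\mu(a,a,b)=a$; (M2) $\mu(a_1,a_2,a_3)$ is invariant under permutations of its arguments; (C1) there is an affine $\rho(t)=Kt+H_0$ with $d(\mu(a,b,c),\mu(a',b',c'))\leqslant\rho(d(a,a')+d(b,b')+d(c,c'))$ for all points; (C2) there is $H\colon\mathbb N\to[0,\infty)$ such that for every finite $A\subseteq X$ with $1\leqslant|A|\leqslant p$ there are a finite median algebra $(\Pi,\mu_\Pi)$ and maps $\pi\colon A\to\Pi$, $\lambda\colon\Pi\to X$ with $\lambda\mu_\Pi(x,y,z)\sim_{H(p)}\mu(\lambda x,\lambda y,\lambda z)$ for all $x,y,z\in\Pi$ and $\lambda\pi a\sim_{H(p)}a$ for all $a\in A$. (A median algebra is a set with a ternary operation $m$ satisfying $m(a,a,b)=a$, full symmetry, and $m(m(a,b,c),b,d)=m(a,b,m(c,b,d))$.) The rank of a median algebra is the supremum of $n$ such that it contains a subalgebra isomorphic to $I^n=(\mathbb Z_2)^n$ with coordinatewise majority vote as median. The coarse median space has rank at most $n$ if there exist $\rho,H$ as in (C1),(C2) for which $\Pi$ in (C2) can always be chosen of rank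 at most $n$. The interval is $[a,b]=\{\mu(a,y,b):y\in X\}$, and for $S\subseteq X$, $\mathcal N_\lambda(S)=\{y\in X:\exists s\in S,\ d(y,s)\leqslant\lambda\}$. *)

theory Defs
  imports Complex_Main
begin

definition median_algebra :: "'b set \<Rightarrow> ('b \<Rightarrow> 'b \<Rightarrow> 'b \<Rightarrow> 'b) \<Rightarrow> bool" where
  "median_algebra P m \<longleftrightarrow>
     (\<forall>a\<in>P. \<forall>b\<in>P. \<forall>c\<in>P. m a b c \<in> P) \<and>
     (\<forall>a\<in>P. \<forall>b\<in>P. m a a b = a) \<and>
     (\<forall>a\<in>P. \<forall>b\<in>P. \<forall>c\<in>P.
        m a b c = m b a c \<and> m a b c = m a c b \<and> m a b c = m c b a \<and>
        m a b c = m b c a \<and> m a b c = m c a b) \<and>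
     (\<forall>a\<in>P. \<forall>b\<in>P. \<forall>c\<in>P. \<forall>d\<in>P. m (m a b c) b d = m a b (m c b d))"

definition cube :: "nat \<Rightarrow> (nat \<Rightarrow> bool) set" where
  "cube k = {f. \<forall>i\<ge>k. f i = False}"

definition majority :: "(nat \<Rightarrow> bool) \<Rightarrow> (nat \<Rightarrow> bool) \<Rightarrow> (nat \<Rightarrow> bool) \<Rightarrow> (nat \<Rightarrow> bool)" where
  "majority f g h = (\<lambda>i. (f i \<and> g i) \<or> (g i \<and> h i) \<or> (f i \<and> h i))"

text \<open>P contains a subalgebra isomorphic to I^k: an injective median homomorphism I^k \<rightarrow> P
  (its image is then a subalgebra isomorphic to I^k).\<close>

definition contains_cube :: "'b set \<Rightarrow> ('b \<Rightarrow> 'b \<Rightarrow> 'b \<Rightarrow> 'b) \<Rightarrow> nat \<Rightarrow> bool" where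
  "contains_cube P m k \<longleftrightarrow>
     (\<exists>\<phi>. inj_on \<phi> (cube k) \<and> \<phi> ` cube k \<subseteq> P \<and>
        (\<forall>x\<in>cube k. \<forall>y\<in>cube k. \<forall>z\<in>cube k. \<phi> (majority x y z) = m (\<phi> x) (\<phi> y) (\<phi> z)))"

definition median_rank_le :: "'b set \<Rightarrow> ('b \<Rightarrow> 'b \<Rightarrow> 'b \<Rightarrow> 'b) \<Rightarrow> nat \<Rightarrow> bool" where
  "median_rank_le P m n \<longleftrightarrow> (\<forall>k. contains_cube P m k \<longrightarrow> k \<le> n)"

definition cm_M1 :: "('a \<Rightarrow> 'a \<Rightarrow> 'a \<Rightarrow> 'a) \<Rightarrow> bool" where
  "cm_M1 mu \<longleftrightarrow> (\<forall>a b. mu a a b = a)"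

definition cm_M2 :: "('a \<Rightarrow> 'a \<Rightarrow> 'a \<Rightarrow> 'a) \<Rightarrow> bool" where
  "cm_M2 mu \<longleftrightarrow> (\<forall>a b c.
      mu a b c = mu b a c \<and> mu a b c = mu a c b \<and> mu a b c = mu c b a \<and>
      mu a b c = mu b c a \<and> mu a b c = mu c a b)"

definition cm_C1 :: "('a::metric_space \<Rightarrow> 'a \<Rightarrow> 'a \<Rightarrow> 'a) \<Rightarrow> real \<Rightarrow> real \<Rightarrow> bool" where
  "cm_C1 mu K H0 \<longleftrightarrow> (\<forall>a b c a' b' c'.
      dist (mu a b c) (mu a' b' c') \<le> K * (dist a a' + dist b b' + dist c c') + H0)"

text \<open>Condition (C2), with an extra requirement Q on the approximating finite median algebra.
  Finite median algebras are represented on finite subsets of nat (every finite median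
  algebra is isomorphic to one of these).\<close>

definition cm_C2 :: "('a::metric_space \<Rightarrow> 'a \<Rightarrow> 'a \<Rightarrow> 'a) \<Rightarrow> (nat \<Rightarrow> real)
     \<Rightarrow> (nat set \<Rightarrow> (nat \<Rightarrow> nat \<Rightarrow> nat \<Rightarrow> nat) \<Rightarrow> bool) \<Rightarrow> bool" where
  "cm_C2 mu H Q \<longleftrightarrow> (\<forall>(p::nat) (A::'a set). finite A \<and> 1 \<le> card A \<and> card A \<le> p \<longrightarrow>
      (\<exists>(P::nat set) m (pi::'a \<Rightarrow> nat) (lam::nat \<Rightarrow> 'a).
         finite P \<and> median_algebra P m \<and> Q P m \<and> pi ` A \<subseteq> P \<and>
         (\<forall>x\<in>P. \<forall>y\<in>P. \<forall>z\<in>P. dist (lam (m x y z)) (mu (lam x) (lam y) (lam z)) \<le> H p) \<and>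
         (\<forall>a\<in>A. dist (lam (pi a)) a \<le> H p)))"

definition coarse_median_space :: "('a::metric_space \<Rightarrow> 'a \<Rightarrow> 'a \<Rightarrow> 'a) \<Rightarrow> bool" where
  "coarse_median_space mu \<longleftrightarrow> cm_M1 mu \<and> cm_M2 mu \<and>
     (\<exists>K H0. cm_C1 mu K H0) \<and> (\<exists>H. cm_C2 mu H (\<lambda>_ _. True))"

definition cm_rank_le :: "('a::metric_space \<Rightarrow> 'a \<Rightarrow> 'a \<Rightarrow> 'a) \<Rightarrow> nat \<Rightarrow> bool" where
  "cm_rank_le mu n \<longleftrightarrow>
     (\<exists>K H0 H. cm_C1 mu K H0 \<and> cm_C2 mu H (\<lambda>P m. median_rank_le P m n))"

definition cm_interval :: "('a \<Rightarrow> 'a \<Rightarrow> 'a \<Rightarrow> 'a) \<Rightarrow> 'a \<Rightarrow> 'a \<Rightarrow> 'a set" where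
  "cm_interval mu a b = {mu a y b | y. True}"

definition nbhd :: "real \<Rightarrow> 'a::metric_space set \<Rightarrow> 'a set" where
  "nbhd l S = {y. \<exists>s\<in>S. dist y s \<le> l}"

end

theory Submission
  imports Defs
begin

text \<open>If the rank is at most 1, approximate \<open>a\<close>, \<open>b\<close> and points defining \<open>x, y \<in> [a, b]\<close> by a finite
  median algebra of rank at most 1. Two points of an interval \<open>[a, b]\<close> in a median algebra span a
  square with their meet and join, so in rank 1 they are comparable in \<open>[a, b]\<close>.

  Conversely, let \<open>\<lambda> : P \<rightarrow> X\<close> be an approximation of a finite set \<open>A\<close>, where \<open>P\<close> may be assumed
  to be generated by \<open>A\<close>. An edge of \<open>P\<close> divides it into two halfspaces, by the distributive law.
  If two such divisions cross, then \<open>P\<close> contains a square with a corner in each of the four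
  quadrants; intervals being thin, two opposite sides of its image are short, and projecting them
  to the edge which they cross shows that the image of this edge is short. Hence the divisions by
  long edges do not cross, and identifying the points of \<open>P\<close> that no long edge separates leaves a
  median algebra of rank at most 1. As halfspaces are determined by their traces on \<open>A\<close>, there are
  at most \<open>2 ^ |A|\<close> of them, which bounds the number of short edges between two identified points.\<close>

section \<open>Betweenness in median algebras\<close>

locale median =
  fixes P :: "'b set" and m :: "'b \<Rightarrow> 'b \<Rightarrow> 'b \<Rightarrow> 'b"
  assumes median_algebra: "median_algebra P m"
begin

lemma m_closed [simp]: "\<lbrakk>a \<in> P; b \<in> P; c \<in> P\<rbrakk> \<Longrightarrow> m a b c \<in> P"
  using median_algebra unfolding median_algebra_def by blast

lemma m_commute:
  assumes "a \<in> P" "b \<in> P" "c \<in> P"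
  shows "m a b c = m b a c" "m a b c = m a c b"
  using median_algebra assms unfolding median_algebra_def by blast+

lemma m_idem [simp]:
  assumes "a \<in> P" "b \<in> P"
  shows "m a a b = a" "m a b a = a" "m b a a = a"
proof -
  show "m a a b = a"
    using median_algebra assms unfolding median_algebra_def by blast
  then show "m a b a = a" "m b a a = a"
    using m_commute assms by metis+
qed

lemma m_assoc:
  assumes "b \<in> P" "x \<in> P" "y \<in> P" "z \<in> P"
  shows "m b (m b x y) z = m b x (m b y z)"
proof -
  have "m (m x b y) b z = m x b (m y b z)"
    using median_algebra assms unfolding median_algebra_def by blast
  then show ?thesis
    using m_commute assms m_closed by metis
qed

definition between :: "'b \<Rightarrow> 'b \<Rightarrow> 'b \<Rightarrow> bool" where
  "between a x b \<longleftrightarrow> a \<in> P \<and> x \<in> P \<and> b \<in> P \<and> m a x b = x"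

lemma between_commute: "between a x b \<longleftrightarrow> between b x a"
  using m_commute unfolding between_def by metis

lemma between_bottom: "\<lbrakk>a \<in> P; b \<in> P\<rbrakk> \<Longrightarrow> between a a b"
  by (simp add: between_def)

lemma between_refl: "\<lbrakk>a \<in> P; b \<in> P\<rbrakk> \<Longrightarrow> between a b b"
  by (simp add: between_def)

lemma between_same_iff: "between a x a \<longleftrightarrow> a \<in> P \<and> x = a"
  by (auto simp: between_def)

text \<open>For fixed \<open>u\<close>, the relation \<open>between u x y\<close> is a partial order with least element \<open>u\<close>
  in which \<open>m u x y\<close> is the meet of \<open>x\<close> and \<open>y\<close>.\<close>

lemma between_antisym: "\<lbrakk>between u x y; between u y x\<rbrakk> \<Longrightarrow> x = y"
  using m_commute unfolding between_def by metis

lemma between_trans: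
  assumes "between u x y" "between u y z"
  shows "between u x z"
  using assms m_assoc[of u x y z] by (simp add: between_def)

lemma between_trans_inner:
  assumes "between u x y" "between u y z"
  shows "between x y z"
proof -
  have P: "u \<in> P" "x \<in> P" "y \<in> P" "z \<in> P" and "m u x y = x" "m u y z = y"
    using assms by (simp_all add: between_def)
  then have "m y x u = x" "m y u z = y"
    by (metis m_commute)+
  then have "m y x z = y"
    using m_assoc[of y x u z] P by simp
  then show ?thesis
    using m_commute[of y x z] P by (simp add: between_def)
qed

lemma median_between:
  assumes "a \<in> P" "b \<in> P" "c \<in> P"
  shows "between a (m a b c) b" "between a (m a b c) c" "between b (m a b c) c"
proof -
  have below: "between u (m u x y) y" if "u \<in> P" "x \<in> P" "y \<in> P" for u x y
    using m_assoc[of u x y y] that by (simp add: between_def)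
  show "between a (m a b c) b" "between a (m a b c) c" "between b (m a b c) c"
    using below[of a c b] below[of a b c] below[of b a c] assms by (metis m_commute)+
qed

lemma between_median:
  assumes "between u s x" "between u s y"
  shows "between u s (m u x y)"
  using assms m_assoc[of u s x y] by (simp add: between_def)

lemma between_median_iff:
  assumes "u \<in> P" "x \<in> P" "y \<in> P"
  shows "between u s (m u x y) \<longleftrightarrow> between u s x \<and> between u s y"
  using between_median between_trans median_between(1,2)[OF assms] by blast

lemma join_between:
  assumes "between u x t" "between u y t" "between u t z"
  shows "between u (m z x y) t"
proof -
  have "between x t z" "between y t z"
    using assms between_trans_inner by blast+
  then have "between z t (m z x y)"
    using between_median between_commute by blast
  moreover have "between z (m z x y) u"
  proof (rule between_trans)
    show "between z (m z x y) x"
      using assms median_between(1) by (simp add: between_def)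
    show "between z x u"
      using between_trans[OF assms(1,3)] between_commute by blast
  qed
  ultimately show ?thesis
    using between_trans_inner between_commute by blast
qed

section \<open>The distributive law\<close>

text \<open>In the order with least element \<open>u\<close>, the median \<open>m x y z\<close> is the least upper bound of the
  three pairwise meets.\<close>

lemma meet_between_median:
  assumes P: "u \<in> P" "x \<in> P" "y \<in> P" "z \<in> P"
  shows "between u (m u x y) (m x y z)"
proof (rule between_trans)
  define r where "r = m u x y"
  have r: "r \<in> P" "between u r y"
    using P median_between by (simp_all add: r_def)
  have "m y u (m x y z) = m y u (m y x z)"
    using m_commute P by metis
  also have "\<dots> = m y (m y u x) z"
    using m_assoc P by simp
  also have "m y u x = r"
    using m_commute P unfolding r_def by metis
  finally have meet: "m y u (m x y z) = m y r z" .
  have "m r u (m r y z) = m r (m r u y) z"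
    using m_assoc P r by simp
  also have "m r u y = r"
    using r P m_commute by (metis between_def)
  finally have "m u r (m y r z) = r"
    using m_commute[of u r "m y r z"] m_commute[of y r z] P r by simp
  then show "between u (m u x y) (m y u (m x y z))"
    using P r by (simp add: between_def meet r_def[symmetric])
  show "between u (m y u (m x y z)) (m x y z)"
    using median_between P by simp
qed

lemma meet_median_eq_join:
  assumes P: "u \<in> P" "x \<in> P" "y \<in> P" "z \<in> P"
  shows "m u x (m x y z) = m x (m u x y) (m u x z)"
proof -
  have "m x u (m x y z) = m x u (m x u (m x y z))"
    using m_assoc[of x u u "m x y z"] P by simp
  also have "\<dots> = m x u (m x (m x u y) z)"
    using m_assoc[of x u y z] P by simp
  also have "\<dots> = m x (m x u y) (m x u z)"
    using m_assoc[of x "m x u y" u z] m_assoc[of x u "m x u y" z]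
      m_commute(2)[of x u "m x u y"] P by simp
  finally show ?thesis
    using m_commute(1)[of u x] P by simp
qed

lemma median_eq_join_meets:
  assumes P: "u \<in> P" "x \<in> P" "y \<in> P" "z \<in> P"
  defines "w \<equiv> m x y z"
  shows "m w (m u w x) (m u w y) = w"
proof -
  have w: "w \<in> P" "m w x y = w"
    using P median_between m_commute unfolding w_def between_def by (simp, metis m_closed)
  have "m w (m w u x) (m w u y) = m w u (m w x (m w y u))"
    using m_assoc m_commute(2)[of w u y] P w(1) by simp
  also have "\<dots> = m w u (m w w u)"
    using m_assoc[of w x y u] P w by simp
  finally show ?thesis
    using m_commute(1)[of u w] P w(1) by simp
qed

lemma median_between_if_meets_between:
  assumes xy: "between u (m u x y) s" and xz: "between u (m u x z) s"
    and yz: "between u (m u y z) s"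
    and P: "x \<in> P" "y \<in> P" "z \<in> P"
  shows "between u (m x y z) s"
proof -
  have us: "u \<in> P" "s \<in> P"
    using xy by (simp_all add: between_def)
  define w where "w = m x y z"
  have w: "w \<in> P"
    using P by (simp add: w_def)
  have meet_below: "between u (m u a (m a b c)) s"
    if "between u (m u a b) s" "between u (m u a c) s" and P: "a \<in> P" "b \<in> P" "c \<in> P" for a b c
  proof -
    have "between u (m u a b) (m u a s)" "between u (m u a c) (m u a s)"
      using that us median_between(1) by (auto intro: between_median)
    then have "between u (m a (m u a b) (m u a c)) (m u a s)"
      by (rule join_between) (use us P median_between(1) in simp)
    then show ?thesis
      using meet_median_eq_join us P median_between(2) between_trans by metis
  qed
  have "m y x z = w"
    using m_commute P by (simp add: w_def)
  then have "between u (m u w x) s" "between u (m u w y) s"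
    using meet_below[of x y z] meet_below[of y x z] xy xz yz P us w
      m_commute(2)[of u x w] m_commute(2)[of u y w] m_commute(2)[of u x y]
    by (simp_all add: w_def)
  then have "between u (m u w x) (m u w s)" "between u (m u w y) (m u w s)"
    using P us w median_between(1) by (auto intro: between_median)
  then have "between u (m w (m u w x) (m u w y)) (m u w s)"
    by (rule join_between) (use us w median_between(1) in simp)
  then have "between u w (m u w s)"
    using median_eq_join_meets us P by (simp add: w_def)
  then show ?thesis
    using between_trans us w median_between(2) w_def by blast
qed

lemma meet_eq_bottom_mono:
  assumes "m u x y = u" "between u x' x" "between u y' y"
  shows "m u x' y' = u"
proof -
  have "between u (m u x' y') x'" "between u (m u x' y') y'"
    using assms(2,3) median_between(1,2) by (simp_all add: between_def)
  then have "between u (m u x' y') (m u x y)"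
    using assms(2,3) between_trans by (blast intro: between_median)
  then show ?thesis
    using assms(1) by (simp add: between_same_iff)
qed

text \<open>With \<open>w = m x y z\<close>, and after replacing \<open>v\<close>, \<open>x\<close>, \<open>y\<close> by their meets with \<open>w\<close>, the element
  \<open>t = m x y v\<close> is the least upper bound of the pairwise meets both for the order based at \<open>u\<close>,
  so that \<open>t \<le> x\<close>, and for the reversed order based at \<open>w\<close>, so that \<open>v \<le> t\<close>.\<close>

lemma meet_median_eq_bottom:
  assumes P: "u \<in> P" "v \<in> P" "x \<in> P" "y \<in> P" "z \<in> P"
    and x: "m u v x = u" and y: "m u v y = u"
  shows "m u v (m x y z) = u"
proof -
  define w where "w = m x y z"
  define v' where "v' = m u w v"
  define x' where "x' = m u w x"
  define y' where "y' = m u w y"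
  define t where "t = m x' y' v'"
  have P': "w \<in> P" "v' \<in> P" "x' \<in> P" "y' \<in> P"
    using P by (simp_all add: w_def v'_def x'_def y'_def)
  have le: "between u v' v" "between u x' x" "between u y' y" "between u v' w"
    using median_between P P' by (simp_all add: v'_def x'_def y'_def)
  have "m u v' x' = u" "m u v' y' = u"
    using meet_eq_bottom_mono x y le by blast+
  then have "between u t x'"
    using median_between_if_meets_between[of u x' y' x' v'] median_between(1)[of u x' y'] P P'
    by (simp add: t_def m_commute between_bottom)
  moreover have "between w t v'"
  proof -
    have "m w x' y' = w"
      using median_eq_join_meets P by (simp add: w_def x'_def y'_def)
    then show ?thesis
      using median_between_if_meets_between[of w x' y' v' v'] median_between(2) P'
      by (simp add: t_def between_bottom)
  qed
  then have "between u v' t"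
    using between_trans_inner le(4) between_commute by blast
  ultimately have "between u v' x"
    using between_trans le(2) by blast
  then have "v' = u"
    using meet_eq_bottom_mono[OF x le(1), of v'] P P' by simp
  then show ?thesis
    using m_commute(2)[of u v w] P P' by (simp add: v'_def w_def)
qed

lemma between_if_meets_between:
  assumes t: "between u t (m x y z)" and x: "between u (m u t x) r" and y: "between u (m u t y) r"
    and P: "x \<in> P" "y \<in> P" "z \<in> P"
  shows "between u t r"
proof -
  have utr: "u \<in> P" "t \<in> P" "r \<in> P"
    using t x by (simp_all add: between_def)
  define s where "s = m u t r"
  have s: "s \<in> P" "between u s t" "between u s r" "m u s t = s"
    using utr median_between by (simp_all add: s_def between_def)
  have bottom: "m s t a = s" if a: "a \<in> P" "between u (m u t a) r" for a
  proof (rule between_antisym)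
    have "between u (m u t a) s"
      unfolding s_def using a utr median_between(1) by (auto intro: between_median)
    then show "between u (m s t a) s"
      using median_between_if_meets_between[of u s t s a] median_between(1)[of u s a] a(1) utr s
      by (simp add: between_refl)
    show "between u s (m s t a)"
      using meet_between_median[of u s t a] a(1) utr s by simp
  qed
  have "m s t (m x y z) = s"
    using meet_median_eq_bottom[OF s(1) utr(2) P] bottom P x y by blast
  moreover have "m s t (m x y z) = t"
    using between_trans_inner[OF s(2) t] by (simp add: between_def)
  ultimately show ?thesis
    using s(3) by simp
qed

lemma between_if_pairwise_meets_between:
  assumes t: "between u t (m x y z)" and P: "x \<in> P" "y \<in> P" "z \<in> P"
    and xy: "between u (m u t (m u x y)) r" and xz: "between u (m u t (m u x z)) r"
    and yz: "between u (m u t (m u y z)) r"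
  shows "between u t r"
proof -
  have ut: "u \<in> P" "t \<in> P"
    using t by (simp_all add: between_def)
  have "between u (m u t a) r"
    if P': "a \<in> P" "b \<in> P" "c \<in> P" and median: "m a b c = m x y z"
      and ab: "between u (m u t (m u a b)) r" and ac: "between u (m u t (m u a c)) r" for a b c
  proof (rule between_if_meets_between)
    have "between u (m u t a) (m u a (m x y z))"
      using between_trans[OF _ t] median_between(1,2) ut P P' by (simp add: between_median_iff)
    also have "m u a (m x y z) = m (m u a b) (m u a c) a"
      using meet_median_eq_join[of u a b c] median ut P' by (simp add: m_commute)
    finally show "between u (m u t a) (m (m u a b) (m u a c) a)" .
    show "between u (m u (m u t a) (m u a b)) r" "between u (m u (m u t a) (m u a c)) r"
      using m_assoc[of u t a] m_assoc[of u a a] ab ac ut P' by simp_all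
  qed (use ut P' in simp_all)
  from this[of x y z] this[of y x z] show ?thesis
    using between_if_meets_between[OF t _ _ P] xy xz yz ut P by (simp add: m_commute)
qed

lemma median_meets_between_meet_median:
  assumes P: "u \<in> P" "v \<in> P" "x \<in> P" "y \<in> P" "z \<in> P"
  shows "between u (m (m u v x) (m u v y) (m u v z)) (m u v (m x y z))"
proof -
  have "between u (m u (m u v a) (m u v b)) (m u v (m x y z))"
    if ab: "a \<in> P" "b \<in> P" "between u (m u a b) (m x y z)" for a b
  proof -
    let ?s = "m u (m u v a) (m u v b)"
    have "between u ?s v" "between u ?s (m u a b)"
      using between_refl[of u ?s] P ab(1,2) by (auto simp: between_median_iff)
    then show ?thesis
      using between_median between_trans ab(3) by blast
  qed
  moreover have "between u (m u x y) (m x y z)" "between u (m u x z) (m x y z)"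
    "between u (m u y z) (m x y z)"
    using P meet_between_median[of u x y z] meet_between_median[of u x z y]
      meet_between_median[of u y z x] by (simp_all add: m_commute)
  ultimately show ?thesis
    using P by (simp add: median_between_if_meets_between)
qed

lemma meet_median_between_median_meets:
  assumes P: "u \<in> P" "v \<in> P" "x \<in> P" "y \<in> P" "z \<in> P"
  shows "between u (m u v (m x y z)) (m (m u v x) (m u v y) (m u v z))"
proof -
  define t where "t = m u v (m x y z)"
  define r where "r = m (m u v x) (m u v y) (m u v z)"
  have t: "t \<in> P" "between u t v" "between u t (m x y z)"
    using P median_between by (simp_all add: t_def)
  have meets: "between u (m u (m u v x) (m u v y)) r" "between u (m u (m u v x) (m u v z)) r"
    "between u (m u (m u v y) (m u v z)) r"
    using P meet_between_median[of u "m u v x" "m u v y" "m u v z"]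
      meet_between_median[of u "m u v x" "m u v z" "m u v y"]
      meet_between_median[of u "m u v y" "m u v z" "m u v x"]
    by (simp_all add: r_def m_commute)
  have "between u (m u t (m u a b)) r"
    if ab: "a \<in> P" "b \<in> P" "between u (m u (m u v a) (m u v b)) r" for a b
  proof -
    let ?s = "m u t (m u a b)"
    have "between u ?s t" "between u ?s a" "between u ?s b"
      using between_refl[of u ?s] P(1) t(1) ab(1,2) by (auto simp: between_median_iff)
    then have "between u ?s (m u (m u v a) (m u v b))"
      using between_trans[OF _ t(2)] P(1,2) ab(1,2) by (simp add: between_median_iff)
    then show ?thesis
      using between_trans[OF _ ab(3)] by blast
  qed
  then have "between u t r"
    using between_if_pairwise_meets_between[OF t(3) P(3-5)] meets P(3-5) by blast
  then show ?thesis
    by (simp add: t_def r_def)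
qed

lemma median_distrib:
  assumes P: "u \<in> P" "v \<in> P" "x \<in> P" "y \<in> P" "z \<in> P"
  shows "m u v (m x y z) = m (m u v x) (m u v y) (m u v z)"
  using assms
  by (intro between_antisym[OF meet_median_between_median_meets median_meets_between_meet_median])

end

section \<open>Halfspaces, squares and rank\<close>

definition halfspace :: "'b set \<Rightarrow> ('b \<Rightarrow> 'b \<Rightarrow> 'b \<Rightarrow> 'b) \<Rightarrow> 'b set \<Rightarrow> bool" where
  "halfspace P m S \<longleftrightarrow> S \<subseteq> P \<and>
     (\<forall>x\<in>P. \<forall>y\<in>P. \<forall>z\<in>P. m x y z \<in> S \<longleftrightarrow>
        x \<in> S \<and> y \<in> S \<or> y \<in> S \<and> z \<in> S \<or> x \<in> S \<and> z \<in> S)"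

definition crossing :: "'b set \<Rightarrow> 'b set \<Rightarrow> 'b set \<Rightarrow> bool" where
  "crossing P S T \<longleftrightarrow> S \<inter> T \<noteq> {} \<and> S - T \<noteq> {} \<and> T - S \<noteq> {} \<and> P - (S \<union> T) \<noteq> {}"

definition separates_points :: "'b set set \<Rightarrow> 'b set \<Rightarrow> bool" where
  "separates_points W P \<longleftrightarrow> (\<forall>x\<in>P. \<forall>y\<in>P. (\<forall>S\<in>W. x \<in> S \<longleftrightarrow> y \<in> S) \<longrightarrow> x = y)"

lemma halfspace_subset: "halfspace P m S \<Longrightarrow> S \<subseteq> P"
  by (simp add: halfspace_def)

lemma halfspace_median_iff:
  assumes "halfspace P m S" "x \<in> P" "y \<in> P" "z \<in> P"
  shows "m x y z \<in> S \<longleftrightarrow> x \<in> S \<and> y \<in> S \<or> y \<in> S \<and> z \<in> S \<or> x \<in> S \<and> z \<in> S"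
  using assms unfolding halfspace_def by blast

lemma contains_cube_mono:
  assumes "contains_cube P m k" "j \<le> k"
  shows "contains_cube P m j"
proof -
  have "cube j \<subseteq> cube k"
    using assms(2) by (auto simp: cube_def)
  then show ?thesis
    using assms(1) unfolding contains_cube_def by (meson image_mono inj_on_subset subset_iff)
qed

lemma median_rank_le_iff: "median_rank_le P m n \<longleftrightarrow> \<not> contains_cube P m (Suc n)"
  unfolding median_rank_le_def using contains_cube_mono not_less_eq_eq by blast

context median
begin

lemma halfspace_between_iff:
  assumes "halfspace P m S" "between a x b" "a \<in> S \<longleftrightarrow> b \<in> S"
  shows "x \<in> S \<longleftrightarrow> a \<in> S"
  using halfspace_median_iff[OF assms(1), of a x b] assms(2,3) by (auto simp: between_def)

text \<open>The vertices are listed in cyclic order. A square is non-degenerate if \<open>p \<noteq> x\<close> and \<open>p \<noteq> y\<close>.\<close>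

definition square :: "'b \<Rightarrow> 'b \<Rightarrow> 'b \<Rightarrow> 'b \<Rightarrow> bool" where
  "square p x q y \<longleftrightarrow> between p x q \<and> between x q y \<and> between q y p \<and> between y p x"

lemma square_if_between:
  assumes x: "between a x b" and y: "between a y b"
  shows "square (m a x y) x (m b x y) y"
proof -
  have P: "a \<in> P" "b \<in> P" "x \<in> P" "y \<in> P"
    using x y by (simp_all add: between_def)
  have opposite: "between (m a s t) s (m b s t)" if s: "between a s b" and "t \<in> P" for s t
  proof -
    have "between a (m a s t) s" "between b (m b s t) s"
      using s \<open>t \<in> P\<close> median_between(1) by (simp_all add: between_def)
    then have "between b s (m a s t)"
      using between_trans_inner[of a "m a s t" s b] s between_commute by blast
    then show ?thesis
      using between_trans_inner[OF \<open>between b (m b s t) s\<close>] between_commute by blast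
  qed
  have "between (m a x y) x (m b x y)" "between (m b x y) y (m a x y)"
    using opposite[OF x P(4)] opposite[OF y P(3)] between_commute P by (simp_all add: m_commute(2))
  then show ?thesis
    using median_between(3) P between_commute by (simp add: square_def)
qed

lemma contains_cube_2_if_square:
  assumes sq: "square p x q y" and "p \<noteq> x" "p \<noteq> y"
  shows "contains_cube P m 2"
proof -
  have P: "p \<in> P" "x \<in> P" "q \<in> P" "y \<in> P"
    and med: "m p x q = x" "m x q y = q" "m q y p = y" "m y p x = p"
    using sq by (simp_all add: square_def between_def)
  have perms: "m p q x = x" "m x p q = x" "m x q p = x" "m q p x = x" "m q x p = x"
    "m x y q = q" "m q x y = q" "m q y x = q" "m y x q = q" "m y q x = q"
    "m q p y = y" "m y q p = y" "m y p q = y" "m p q y = y" "m p y q = y"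
    "m y x p = p" "m p y x = p" "m p x y = p" "m x y p = p" "m x p y = p"
    using med P m_commute by metis+
  have distinct: "distinct [p, x, q, y]"
    using med perms P \<open>p \<noteq> x\<close> \<open>p \<noteq> y\<close> by auto
  define \<phi> where "\<phi> f = (if f 0 then if f 1 then q else x else if f 1 then y else p)"
    for f :: "nat \<Rightarrow> bool"
  have "inj_on \<phi> (cube 2)"
  proof (rule inj_onI, rule ext)
    fix f g and i :: nat
    assume fg: "f \<in> cube 2" "g \<in> cube 2" "\<phi> f = \<phi> g"
    then have "f 0 = g 0" "f 1 = g 1"
      using distinct by (auto simp: \<phi>_def split: if_splits)
    moreover have "i = 0 \<or> i = 1 \<or> i \<ge> 2"
      by arith
    ultimately show "f i = g i"
      using fg by (auto simp: cube_def)
  qed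
  moreover have "\<phi> (majority f g h) = m (\<phi> f) (\<phi> g) (\<phi> h)" for f g h
    using med perms P by (simp add: \<phi>_def majority_def)
  ultimately show ?thesis
    using P unfolding contains_cube_def by (intro exI[of _ \<phi>]) (auto simp: \<phi>_def)
qed

lemma square_if_contains_cube_2:
  assumes "contains_cube P m 2"
  obtains p x q y where "square p x q y" "p \<noteq> x" "p \<noteq> y"
proof -
  obtain \<phi> where inj: "inj_on \<phi> (cube 2)" and ran: "\<phi> ` cube 2 \<subseteq> P"
    and hom: "\<And>f g h. \<lbrakk>f \<in> cube 2; g \<in> cube 2; h \<in> cube 2\<rbrakk> \<Longrightarrow>
      \<phi> (majority f g h) = m (\<phi> f) (\<phi> g) (\<phi> h)"
    using assms unfolding contains_cube_def by auto
  define corner :: "bool \<Rightarrow> bool \<Rightarrow> nat \<Rightarrow> bool"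
    where "corner i j = (\<lambda>n. n = 0 \<and> i \<or> n = 1 \<and> j)" for i j
  have cube: "corner i j \<in> cube 2" for i j
    by (auto simp: corner_def cube_def)
  have between: "between (\<phi> f) (\<phi> g) (\<phi> h)"
    if "majority f g h = g" "f \<in> cube 2" "g \<in> cube 2" "h \<in> cube 2" for f g h
    using hom[of f g h] ran that by (auto simp: between_def)
  have "square (\<phi> (corner False False)) (\<phi> (corner True False))
      (\<phi> (corner True True)) (\<phi> (corner False True))"
    unfolding square_def by (intro conjI between cube) (auto simp: majority_def corner_def)
  moreover have "corner False False \<noteq> corner True False" "corner False False \<noteq> corner False True"
    by (auto simp: corner_def fun_eq_iff)
  then have "\<phi> (corner False False) \<noteq> \<phi> (corner True False)"
    "\<phi> (corner False False) \<noteq> \<phi> (corner False True)"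
    using inj_on_eq_iff[OF inj cube cube] by simp_all
  ultimately show thesis
    using that by blast
qed

lemma rank_le_1_iff_squares_degenerate:
  "median_rank_le P m 1 \<longleftrightarrow> (\<forall>p x q y. square p x q y \<longrightarrow> p = x \<or> p = y)"
  using contains_cube_2_if_square square_if_contains_cube_2
  unfolding median_rank_le_iff numeral_2_eq_2 One_nat_def by metis

lemma between_split_if_rank_le_1:
  assumes "median_rank_le P m 1" and x: "between a x b" and y: "between a y b"
  shows "between a y x \<or> between x y b"
proof -
  have "m a x y = x \<or> m a x y = y"
    using assms square_if_between rank_le_1_iff_squares_degenerate by blast
  moreover have "a \<in> P" "x \<in> P" "y \<in> P"
    using x y by (simp_all add: between_def)
  ultimately have "between a x y \<or> between a y x"
    using m_commute(2)[of a x y] by (auto simp: between_def)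
  then show ?thesis
    using between_trans_inner y by blast
qed

lemma square_if_crossing:
  assumes S: "halfspace P m S" and T: "halfspace P m T" and "crossing P S T"
  obtains p x q y where "square p x q y" "p \<notin> S \<union> T" "x \<in> S - T" "q \<in> S \<inter> T" "y \<in> T - S"
proof -
  obtain a b x\<^sub>0 y\<^sub>0 where ab: "a \<in> P - (S \<union> T)" "b \<in> S \<inter> T"
    and xy\<^sub>0: "x\<^sub>0 \<in> S - T" "y\<^sub>0 \<in> T - S"
    using \<open>crossing P S T\<close> unfolding crossing_def by blast
  then have P: "a \<in> P" "b \<in> P" "x\<^sub>0 \<in> P" "y\<^sub>0 \<in> P"
    using halfspace_subset[OF S] halfspace_subset[OF T] by auto
  define x where "x = m a x\<^sub>0 b"
  define y where "y = m a y\<^sub>0 b"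
  have xy: "x \<in> P" "y \<in> P" "between a x b" "between a y b"
    using P median_between m_commute unfolding x_def y_def by simp_all
  note iff = halfspace_median_iff[OF S] halfspace_median_iff[OF T]
  have x: "x \<in> S - T" and y: "y \<in> T - S"
    using ab xy\<^sub>0 P by (simp_all add: x_def y_def iff)
  have "m a x y \<notin> S \<union> T" "m b x y \<in> S \<inter> T"
    using ab x y P xy by (simp_all add: iff)
  then show thesis
    using that square_if_between xy(3,4) x y by blast
qed

lemma rank_le_1_if_noncrossing:
  assumes half: "\<And>S. S \<in> W \<Longrightarrow> halfspace P m S" and sep: "separates_points W P"
    and noncross: "\<And>S T. \<lbrakk>S \<in> W; T \<in> W\<rbrakk> \<Longrightarrow> \<not> crossing P S T"
  shows "median_rank_le P m 1"
  unfolding rank_le_1_iff_squares_degenerate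
proof (intro allI impI, rule ccontr)
  fix p x q y
  assume sq: "square p x q y" and "\<not> (p = x \<or> p = y)"
  then have P: "p \<in> P" "x \<in> P" "q \<in> P" "y \<in> P" and "p \<noteq> x" "p \<noteq> y"
    by (auto simp: square_def between_def)
  then obtain S T where S: "S \<in> W" "p \<in> S \<longleftrightarrow> x \<notin> S" and T: "T \<in> W" "p \<in> T \<longleftrightarrow> y \<notin> T"
    using sep unfolding separates_points_def by metis
  have "q \<in> S \<longleftrightarrow> x \<in> S" "y \<in> S \<longleftrightarrow> p \<in> S"
    using halfspace_between_iff[OF half] sq S unfolding square_def by blast+
  moreover have "q \<in> T \<longleftrightarrow> y \<in> T" "x \<in> T \<longleftrightarrow> p \<in> T"
    using halfspace_between_iff[OF half] sq T unfolding square_def by blast+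
  ultimately have "crossing P S T"
    using S T P unfolding crossing_def by blast
  then show False
    using noncross S T by blast
qed

end

definition median_closed :: "('b \<Rightarrow> 'b \<Rightarrow> 'b \<Rightarrow> 'b) \<Rightarrow> 'b set \<Rightarrow> bool" where
  "median_closed m Q \<longleftrightarrow> (\<forall>x\<in>Q. \<forall>y\<in>Q. \<forall>z\<in>Q. m x y z \<in> Q)"

lemma median_algebra_if_separates_points:
  assumes closed: "median_closed m P"
    and half: "\<And>S. S \<in> W \<Longrightarrow> halfspace P m S" and sep: "separates_points W P"
  shows "median_algebra P m"
proof -
  have eqI: "x = y" if "x \<in> P" "y \<in> P" "\<And>S. S \<in> W \<Longrightarrow> x \<in> S \<longleftrightarrow> y \<in> S" for x y
    using that sep unfolding separates_points_def by blast
  have m: "m x y z \<in> P" if "x \<in> P" "y \<in> P" "z \<in> P" for x y z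
    using that closed unfolding median_closed_def by blast
  show ?thesis
    unfolding median_algebra_def
    by (intro conjI ballI; (rule m | rule eqI); auto simp: m halfspace_median_iff[OF half])
qed

lemma representatives_modulo_separation:
  obtains \<sigma> where "\<And>x. x \<in> P \<Longrightarrow> \<sigma> x \<in> P"
    "\<And>x S. \<lbrakk>x \<in> P; S \<in> W\<rbrakk> \<Longrightarrow> \<sigma> x \<in> S \<longleftrightarrow> x \<in> S" "separates_points W (\<sigma> ` P)"
proof -
  define \<sigma> where "\<sigma> x = (SOME y. y \<in> P \<and> (\<forall>S\<in>W. y \<in> S \<longleftrightarrow> x \<in> S))" for x
  have \<sigma>: "\<sigma> x \<in> P \<and> (\<forall>S\<in>W. \<sigma> x \<in> S \<longleftrightarrow> x \<in> S)" if "x \<in> P" for x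
    unfolding \<sigma>_def by (rule someI[of _ x]) (use that in simp)
  have "\<sigma> x = \<sigma> y" if "x \<in> P" "y \<in> P" "\<forall>S\<in>W. \<sigma> x \<in> S \<longleftrightarrow> \<sigma> y \<in> S" for x y
  proof -
    have "\<forall>S\<in>W. x \<in> S \<longleftrightarrow> y \<in> S"
      using \<sigma>[OF that(1)] \<sigma>[OF that(2)] that(3) by simp
    then show ?thesis
      by (simp add: \<sigma>_def)
  qed
  then have "separates_points W (\<sigma> ` P)"
    by (simp add: separates_points_def)
  then show thesis
    using that[of \<sigma>] \<sigma> by blast
qed

lemma halfspace_image:
  assumes half: "halfspace P m S" and closed: "median_closed m P"
    and \<sigma>P: "\<And>x. x \<in> P \<Longrightarrow> \<sigma> x \<in> P" and \<sigma>S: "\<And>x. x \<in> P \<Longrightarrow> \<sigma> x \<in> S \<longleftrightarrow> x \<in> S"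
  shows "halfspace (\<sigma> ` P) (\<lambda>x y z. \<sigma> (m x y z)) (S \<inter> \<sigma> ` P)"
proof -
  have "\<sigma> (m x y z) \<in> S \<longleftrightarrow> x \<in> S \<and> y \<in> S \<or> y \<in> S \<and> z \<in> S \<or> x \<in> S \<and> z \<in> S"
    "m x y z \<in> P" if "x \<in> \<sigma> ` P" "y \<in> \<sigma> ` P" "z \<in> \<sigma> ` P" for x y z
  proof -
    have xyz: "x \<in> P" "y \<in> P" "z \<in> P"
      using that \<sigma>P by auto
    then show "m x y z \<in> P"
      using closed by (simp add: median_closed_def)
    then show "\<sigma> (m x y z) \<in> S \<longleftrightarrow> x \<in> S \<and> y \<in> S \<or> y \<in> S \<and> z \<in> S \<or> x \<in> S \<and> z \<in> S"
      using \<sigma>S halfspace_median_iff[OF half xyz] by simp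
  qed
  then show ?thesis
    by (simp add: halfspace_def)
qed

text \<open>The quotient of \<open>P\<close> is realised on a set of representatives, so that its carrier stays
  inside \<open>P\<close>.\<close>

lemma noncrossing_quotient:
  assumes closed: "median_closed m P"
    and half: "\<And>S. S \<in> W \<Longrightarrow> halfspace P m S"
    and noncross: "\<And>S T. \<lbrakk>S \<in> W; T \<in> W\<rbrakk> \<Longrightarrow> \<not> crossing P S T"
  obtains \<sigma> where "\<And>x. x \<in> P \<Longrightarrow> \<sigma> x \<in> P"
    "\<And>x S. \<lbrakk>x \<in> P; S \<in> W\<rbrakk> \<Longrightarrow> \<sigma> x \<in> S \<longleftrightarrow> x \<in> S"
    "median_algebra (\<sigma> ` P) (\<lambda>x y z. \<sigma> (m x y z))"
    "median_rank_le (\<sigma> ` P) (\<lambda>x y z. \<sigma> (m x y z)) 1"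
proof -
  obtain \<sigma> where \<sigma>P: "\<And>x. x \<in> P \<Longrightarrow> \<sigma> x \<in> P"
    and \<sigma>W: "\<And>x S. \<lbrakk>x \<in> P; S \<in> W\<rbrakk> \<Longrightarrow> \<sigma> x \<in> S \<longleftrightarrow> x \<in> S"
    and sep: "separates_points W (\<sigma> ` P)"
    using representatives_modulo_separation[of P W] by blast
  define M where "M = (\<lambda>x y z. \<sigma> (m x y z))"
  define V where "V = (\<lambda>S. S \<inter> \<sigma> ` P) ` W"
  have sub: "\<sigma> ` P \<subseteq> P"
    using \<sigma>P by blast
  have closed_M: "median_closed M (\<sigma> ` P)"
    using closed \<sigma>P by (simp add: median_closed_def M_def)
  have half_V: "halfspace (\<sigma> ` P) M S" if "S \<in> V" for S
    using that halfspace_image[OF half closed \<sigma>P \<sigma>W] by (auto simp: V_def M_def)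
  have sep_V: "separates_points V (\<sigma> ` P)"
    using sep by (simp add: separates_points_def V_def)
  have noncross_V: "\<not> crossing (\<sigma> ` P) S T" if "S \<in> V" "T \<in> V" for S T
    using that noncross sub unfolding V_def crossing_def by blast
  have alg: "median_algebra (\<sigma> ` P) M"
    using median_algebra_if_separates_points[OF closed_M half_V sep_V] .
  moreover have "median_rank_le (\<sigma> ` P) M 1"
    by (rule median.rank_le_1_if_noncrossing[OF median.intro[OF alg] half_V sep_V noncross_V])
  ultimately show thesis
    using that[of \<sigma>] \<sigma>P \<sigma>W unfolding M_def by blast
qed

section \<open>Edges\<close>

context median
begin

definition edge :: "'b \<Rightarrow> 'b \<Rightarrow> bool" where
  "edge u v \<longleftrightarrow> u \<in> P \<and> v \<in> P \<and> u \<noteq> v \<and> (\<forall>x. between u x v \<longrightarrow> x = u \<or> x = v)"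

definition side :: "'b \<Rightarrow> 'b \<Rightarrow> 'b set" where
  "side u v = {x \<in> P. m u v x = v}"

lemma edge_median_cases:
  assumes "edge u v" "x \<in> P"
  shows "m u v x = u \<or> m u v x = v"
  using assms median_between(1) unfolding edge_def by blast

lemma edge_side:
  assumes "edge u v"
  shows "u \<notin> side u v" "v \<in> side u v"
  using assms unfolding edge_def side_def by auto

lemma halfspace_side:
  assumes e: "edge u v"
  shows "halfspace P m (side u v)"
proof -
  have uv: "u \<in> P" "v \<in> P" "u \<noteq> v"
    using e by (simp_all add: edge_def)
  have "m u v (m x y z) = v \<longleftrightarrow> m u v x = v \<and> m u v y = v \<or> m u v y = v \<and> m u v z = v
      \<or> m u v x = v \<and> m u v z = v" if "x \<in> P" "y \<in> P" "z \<in> P" for x y z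
    using median_distrib[OF uv(1,2) that] edge_median_cases[OF e] that uv by (metis m_idem)
  then show ?thesis
    by (auto simp: halfspace_def side_def)
qed

lemma exists_edge_towards:
  assumes "finite P" "x \<in> P" "y \<in> P" "x \<noteq> y"
  obtains v where "edge x v" "between x v y"
proof -
  define I where "I = {v. between x v y \<and> v \<noteq> x}"
  define nearer where "nearer s v \<longleftrightarrow> between x s v \<and> s \<noteq> v" for s v
  have "y \<in> I" "I \<subseteq> P"
    using assms by (auto simp: I_def between_def)
  then have "finite I" "I \<noteq> {}"
    using \<open>finite P\<close> finite_subset by blast+
  moreover have "asymp_on I nearer" "transp_on I nearer"
    using between_antisym between_trans unfolding nearer_def
    by (blast intro: asymp_onI transp_onI)+
  ultimately obtain v where v: "v \<in> I" "\<And>s. s \<in> I \<Longrightarrow> s \<noteq> v \<Longrightarrow> \<not> nearer s v"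
    using Finite_Set.bex_min_element[of I nearer] by blast
  have "s = x \<or> s = v" if "between x s v" for s
    using that v between_trans[of x s v y] by (auto simp: I_def nearer_def)
  then have "edge x v"
    using v(1) by (auto simp: edge_def I_def between_def)
  then show thesis
    using that v(1) by (simp add: I_def)
qed

lemma dist_le_card_separating_halfspaces:
  fixes lam :: "'b \<Rightarrow> 'a::metric_space"
  assumes "finite P" "x \<in> P" "y \<in> P" "L \<ge> 0"
    and "\<And>u v. \<lbrakk>edge u v; x \<notin> side u v; y \<in> side u v\<rbrakk> \<Longrightarrow> dist (lam u) (lam v) \<le> L"
  shows "dist (lam x) (lam y) \<le> L * card {S. halfspace P m S \<and> x \<notin> S \<and> y \<in> S}"
  using assms(2,3,5)
proof (induction "card {S. halfspace P m S \<and> x \<notin> S \<and> y \<in> S}" arbitrary: x rule: less_induct)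
  case less
  let ?sep = "\<lambda>x. {S. halfspace P m S \<and> x \<notin> S \<and> y \<in> S}"
  show ?case
  proof (cases "x = y")
    case False
    then obtain v where e: "edge x v" and v: "between x v y"
      using exists_edge_towards[OF \<open>finite P\<close> less.prems(1,2)] by blast
    have vP: "v \<in> P" and y: "y \<in> side x v"
      using v m_commute(2)[of x v y] by (auto simp: between_def side_def)
    have mono: "x \<notin> S" if "halfspace P m S" "v \<notin> S" "y \<in> S" for S
      using halfspace_between_iff[OF that(1) v] that by blast
    then have "?sep v \<subseteq> ?sep x"
      by blast
    moreover have "side x v \<in> ?sep x - ?sep v"
      using y halfspace_side[OF e] edge_side[OF e] by blast
    moreover have "finite (?sep x)"
      by (rule finite_subset[of _ "Pow P"]) (use \<open>finite P\<close> halfspace_subset in auto)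
    ultimately have lt: "card (?sep v) < card (?sep x)"
      by (intro psubset_card_mono) auto
    have "dist (lam x) (lam v) \<le> L"
      using less.prems(3)[OF e] edge_side[OF e] y by blast
    moreover have "dist (lam v) (lam y) \<le> L * card (?sep v)"
      using less.hyps[OF lt vP less.prems(2)] less.prems(3) mono halfspace_side by blast
    ultimately have "dist (lam x) (lam y) \<le> L * (real (card (?sep v)) + 1)"
      using dist_triangle[of "lam x" "lam y" "lam v"] by (simp add: algebra_simps)
    also have "\<dots> \<le> L * card (?sep x)"
      using lt \<open>L \<ge> 0\<close> by (intro mult_left_mono) auto
    finally show ?thesis .
  qed (simp add: \<open>L \<ge> 0\<close>)
qed

end

section \<open>Generated subalgebras\<close>

lemma median_closed_hull: "median_closed m (median_closed m hull B)"
  by (rule hull_in) (auto simp: median_closed_def)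

lemma median_algebra_subset:
  assumes "median_algebra P m" "Q \<subseteq> P" "median_closed m Q"
  shows "median_algebra Q m"
  using assms unfolding median_algebra_def median_closed_def by (meson subset_iff)

lemma card_halfspaces_generated_le:
  assumes gen: "P = median_closed m hull B" and "finite B"
  shows "finite {S. halfspace P m S}" "card {S. halfspace P m S} \<le> 2 ^ card B"
proof -
  have "inj_on (\<lambda>S. S \<inter> B) {S. halfspace P m S}"
  proof (rule inj_onI, clarify)
    fix S T
    assume ST: "halfspace P m S" "halfspace P m T" and trace: "S \<inter> B = T \<inter> B"
    have "median_closed m P"
      by (simp add: gen median_closed_hull)
    then have "median_closed m {x \<in> P. x \<in> S \<longleftrightarrow> x \<in> T}"
      using ST by (auto simp: halfspace_median_iff median_closed_def)
    moreover have "B \<subseteq> {x \<in> P. x \<in> S \<longleftrightarrow> x \<in> T}"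
      using trace by (auto simp: gen intro: hull_inc)
    ultimately have "P \<subseteq> {x \<in> P. x \<in> S \<longleftrightarrow> x \<in> T}"
      unfolding gen by (rule hull_minimal[rotated])
    then show "S = T"
      using halfspace_subset[OF ST(1)] halfspace_subset[OF ST(2)] by blast
  qed
  moreover have "(\<lambda>S. S \<inter> B) ` {S. halfspace P m S} \<subseteq> Pow B"
    by blast
  moreover have "finite (Pow B)"
    using \<open>finite B\<close> by simp
  ultimately show "finite {S. halfspace P m S}" "card {S. halfspace P m S} \<le> 2 ^ card B"
    using card_inj_on_le card_Pow[OF \<open>finite B\<close>] inj_on_finite by metis+
qed

context median
begin

lemma dist_le_if_separating_edges_short:
  fixes lam :: "'b \<Rightarrow> 'a::metric_space"
  assumes gen: "P = median_closed m hull B" and "finite B" "finite P" "x \<in> P" "y \<in> P" "L \<ge> 0"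
    and short: "\<And>u v. \<lbrakk>edge u v; x \<notin> side u v; y \<in> side u v\<rbrakk> \<Longrightarrow> dist (lam u) (lam v) \<le> L"
  shows "dist (lam x) (lam y) \<le> L * 2 ^ card B"
proof -
  let ?sep = "{S. halfspace P m S \<and> x \<notin> S \<and> y \<in> S}"
  have "card ?sep \<le> card {S. halfspace P m S}"
    using card_halfspaces_generated_le(1)[OF gen \<open>finite B\<close>] by (intro card_mono) auto
  then have "card ?sep \<le> 2 ^ card B"
    using card_halfspaces_generated_le(2)[OF gen \<open>finite B\<close>] by linarith
  then have "L * card ?sep \<le> L * 2 ^ card B"
    using \<open>L \<ge> 0\<close> by (intro mult_left_mono) simp_all
  moreover have "dist (lam x) (lam y) \<le> L * card ?sep"
    using dist_le_card_separating_halfspaces[OF assms(3-6) short] .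
  ultimately show ?thesis
    by linarith
qed

lemma collapse_short_edges:
  fixes lam :: "'b \<Rightarrow> 'a::metric_space"
  assumes gen: "P = median_closed m hull B" and "finite B" "finite P" "L \<ge> 0"
    and cross: "\<And>u v u' v'. \<lbrakk>edge u v; edge u' v'; crossing P (side u v) (side u' v')\<rbrakk> \<Longrightarrow>
      dist (lam u) (lam v) \<le> L \<or> dist (lam u') (lam v') \<le> L"
  obtains \<sigma> where "\<And>x. x \<in> P \<Longrightarrow> \<sigma> x \<in> P"
    "median_algebra (\<sigma> ` P) (\<lambda>x y z. \<sigma> (m x y z))"
    "median_rank_le (\<sigma> ` P) (\<lambda>x y z. \<sigma> (m x y z)) 1"
    "\<And>x. x \<in> P \<Longrightarrow> dist (lam (\<sigma> x)) (lam x) \<le> L * 2 ^ card B"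
proof -
  define W where "W = {side u v | u v. edge u v \<and> dist (lam u) (lam v) > L}"
  have "median_closed m P"
    by (simp add: median_closed_def)
  moreover have "halfspace P m S" if "S \<in> W" for S
    using that halfspace_side unfolding W_def by blast
  moreover have "\<not> crossing P S T" if "S \<in> W" "T \<in> W" for S T
    using that cross unfolding W_def by force
  ultimately obtain \<sigma> where \<sigma>P: "\<And>x. x \<in> P \<Longrightarrow> \<sigma> x \<in> P"
    and \<sigma>W: "\<And>x S. \<lbrakk>x \<in> P; S \<in> W\<rbrakk> \<Longrightarrow> \<sigma> x \<in> S \<longleftrightarrow> x \<in> S"
    and quotient: "median_algebra (\<sigma> ` P) (\<lambda>x y z. \<sigma> (m x y z))"
      "median_rank_le (\<sigma> ` P) (\<lambda>x y z. \<sigma> (m x y z)) 1"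
    using noncrossing_quotient[of m P W] by blast
  have "dist (lam (\<sigma> x)) (lam x) \<le> L * 2 ^ card B" if x: "x \<in> P" for x
  proof (rule dist_le_if_separating_edges_short[OF gen \<open>finite B\<close> \<open>finite P\<close> \<sigma>P[OF x] x \<open>L \<ge> 0\<close>])
    fix u v
    assume "edge u v" "\<sigma> x \<notin> side u v" "x \<in> side u v"
    then show "dist (lam u) (lam v) \<le> L"
      using \<sigma>W[OF x] unfolding W_def by force
  qed
  then show thesis
    using that \<sigma>P quotient by blast
qed

end

section \<open>Coarse medians\<close>

definition thin_intervals :: "('a::metric_space \<Rightarrow> 'a \<Rightarrow> 'a \<Rightarrow> 'a) \<Rightarrow> real \<Rightarrow> bool" where
  "thin_intervals mu l \<longleftrightarrow> (\<forall>a b x. x \<in> cm_interval mu a b \<longrightarrow>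
     cm_interval mu a b \<subseteq> nbhd l (cm_interval mu a x) \<union> nbhd l (cm_interval mu x b))"

definition idempotent_intervals :: "('a::metric_space \<Rightarrow> 'a \<Rightarrow> 'a \<Rightarrow> 'a) \<Rightarrow> real \<Rightarrow> bool" where
  "idempotent_intervals mu C \<longleftrightarrow> (\<forall>a b c. dist (mu a (mu a c b) b) (mu a c b) \<le> C)"

definition coarse_square ::
    "('a::metric_space \<Rightarrow> 'a \<Rightarrow> 'a \<Rightarrow> 'a) \<Rightarrow> real \<Rightarrow> 'a \<Rightarrow> 'a \<Rightarrow> 'a \<Rightarrow> 'a \<Rightarrow> bool" where
  "coarse_square mu e p x q y \<longleftrightarrow> dist x (mu p x q) \<le> e \<and> dist q (mu x q y) \<le> e \<and>
     dist y (mu q y p) \<le> e \<and> dist p (mu y p x) \<le> e"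

definition quasi_hom :: "'b set \<Rightarrow> ('b \<Rightarrow> 'b \<Rightarrow> 'b \<Rightarrow> 'b) \<Rightarrow> ('a::metric_space \<Rightarrow> 'a \<Rightarrow> 'a \<Rightarrow> 'a)
    \<Rightarrow> ('b \<Rightarrow> 'a) \<Rightarrow> real \<Rightarrow> bool" where
  "quasi_hom P m mu lam h \<longleftrightarrow>
     (\<forall>x\<in>P. \<forall>y\<in>P. \<forall>z\<in>P. dist (lam (m x y z)) (mu (lam x) (lam y) (lam z)) \<le> h)"

definition approximates :: "('a::metric_space \<Rightarrow> 'a \<Rightarrow> 'a \<Rightarrow> 'a) \<Rightarrow> 'a set \<Rightarrow>
    'b set \<Rightarrow> ('b \<Rightarrow> 'b \<Rightarrow> 'b \<Rightarrow> 'b) \<Rightarrow> ('a \<Rightarrow> 'b) \<Rightarrow> ('b \<Rightarrow> 'a) \<Rightarrow> real \<Rightarrow> bool" where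
  "approximates mu A P m \<pi> lam h \<longleftrightarrow> finite P \<and> median_algebra P m \<and> \<pi> ` A \<subseteq> P \<and>
     quasi_hom P m mu lam h \<and> (\<forall>a\<in>A. dist (lam (\<pi> a)) a \<le> h)"

lemma approximates_mono: "\<lbrakk>approximates mu A P m \<pi> lam h; h \<le> k\<rbrakk> \<Longrightarrow> approximates mu A P m \<pi> lam k"
  unfolding approximates_def quasi_hom_def by force

lemma approximates_generated:
  assumes approx: "approximates mu A P m \<pi> lam h"
  shows "approximates mu A (median_closed m hull (\<pi> ` A)) m \<pi> lam h"
proof -
  let ?Q = "median_closed m hull (\<pi> ` A)"
  have P: "finite P" "median_algebra P m" "\<pi> ` A \<subseteq> P" "quasi_hom P m mu lam h"
    using approx by (simp_all add: approximates_def)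
  then have sub: "?Q \<subseteq> P"
    by (intro hull_minimal) (simp_all add: median_algebra_def median_closed_def)
  moreover have "median_algebra ?Q m"
    by (rule median_algebra_subset[OF P(2) sub median_closed_hull])
  moreover have "quasi_hom ?Q m mu lam h"
    using P(4) sub by (auto simp: quasi_hom_def)
  ultimately show ?thesis
    using approx finite_subset[OF sub P(1)] hull_subset[of "\<pi> ` A" "median_closed m"]
    by (simp add: approximates_def)
qed

lemma cm_C2_iff_approximates:
  "cm_C2 mu H Q \<longleftrightarrow> (\<forall>p A. finite A \<and> 1 \<le> card A \<and> card A \<le> p \<longrightarrow>
     (\<exists>P m \<pi> lam. approximates mu A P m \<pi> lam (H p) \<and> Q P m))"
  unfolding cm_C2_def approximates_def quasi_hom_def by (intro all_cong1 imp_cong ex_cong1) auto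

lemma approximation_of_list:
  assumes C2: "cm_C2 mu H Q" and "xs \<noteq> []" "length xs = p"
  obtains P m \<pi> lam where "approximates mu (set xs) P m \<pi> lam (H p)" "Q P m"
proof -
  have "finite (set xs) \<and> 1 \<le> card (set xs) \<and> card (set xs) \<le> p"
    using assms(2,3) card_length by (auto simp: Suc_le_eq card_gt_0_iff)
  then show thesis
    using C2 that unfolding cm_C2_iff_approximates by meson
qed

locale coarse_median =
  fixes mu :: "'a::metric_space \<Rightarrow> 'a \<Rightarrow> 'a \<Rightarrow> 'a" and K H0 :: real
  assumes M2: "cm_M2 mu" and C1: "cm_C1 mu K H0" and K_nonneg: "K \<ge> 0"
begin

definition \<rho> :: "real \<Rightarrow> real" where
  "\<rho> t = K * t + H0"

lemma \<rho>_mono: "s \<le> t \<Longrightarrow> \<rho> s \<le> \<rho> t"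
  using K_nonneg by (simp add: \<rho>_def mult_left_mono)

lemma mu_commute: "mu a b c = mu b a c" "mu a b c = mu a c b"
  using M2 unfolding cm_M2_def by blast+

lemma dist_mu_le:
  assumes "dist a a' \<le> r" "dist b b' \<le> s" "dist c c' \<le> t"
  shows "dist (mu a b c) (mu a' b' c') \<le> \<rho> (r + s + t)"
proof -
  have "dist (mu a b c) (mu a' b' c') \<le> \<rho> (dist a a' + dist b b' + dist c c')"
    using C1 unfolding cm_C1_def \<rho>_def by blast
  also have "\<dots> \<le> \<rho> (r + s + t)"
    using assms by (intro \<rho>_mono) auto
  finally show ?thesis .
qed

definition coarse_square_bound :: "real \<Rightarrow> real \<Rightarrow> real \<Rightarrow> real" where
  "coarse_square_bound l C e = (e + l) + C + \<rho> (e + l + e) + e"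

lemma thin_coarse_square:
  assumes thin: "thin_intervals mu l" and idem: "idempotent_intervals mu C"
    and sq: "coarse_square mu e p x q y"
  shows "dist y p \<le> coarse_square_bound l C e \<or> dist y q \<le> coarse_square_bound l C e"
proof -
  have short: "dist y c \<le> coarse_square_bound l C e"
    if c: "dist c (mu c y x) \<le> e" and s: "dist (mu p y q) (mu c z (mu p x q)) \<le> l" for c z
  proof -
    let ?s = "mu c z (mu p x q)"
    have "dist y (mu p y q) \<le> e" "dist x (mu p x q) \<le> e"
      using sq mu_commute unfolding coarse_square_def by metis+
    then have "dist y ?s \<le> e + l" "dist x (mu p x q) \<le> e"
      using s dist_triangle[of y ?s "mu p y q"] by simp_all
    moreover from this have "dist (mu c y x) (mu c ?s (mu p x q)) \<le> \<rho> (0 + (e + l) + e)"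
      by (intro dist_mu_le) simp_all
    moreover have "dist ?s (mu c ?s (mu p x q)) \<le> C"
      using idem by (simp add: idempotent_intervals_def dist_commute)
    ultimately show ?thesis
      using c dist_triangle[of y c ?s] dist_triangle[of ?s c "mu c ?s (mu p x q)"]
        dist_triangle[of "mu c ?s (mu p x q)" c "mu c y x"]
      by (simp add: coarse_square_bound_def dist_commute)
  qed
  have "mu p x q \<in> cm_interval mu p q" "mu p y q \<in> cm_interval mu p q"
    by (auto simp: cm_interval_def)
  then have "mu p y q \<in> nbhd l (cm_interval mu p (mu p x q)) \<union>
      nbhd l (cm_interval mu (mu p x q) q)"
    using thin unfolding thin_intervals_def by blast
  then obtain z where
    "dist (mu p y q) (mu p z (mu p x q)) \<le> l \<or> dist (mu p y q) (mu (mu p x q) z q) \<le> l"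
    unfolding nbhd_def cm_interval_def by blast
  moreover have "mu (mu p x q) z q = mu q z (mu p x q)" "mu y p x = mu p y x" "mu x q y = mu q y x"
    using mu_commute by metis+
  ultimately show ?thesis
    using short[of p z] short[of q z] sq by (auto simp: coarse_square_def)
qed

end

locale median_quasi_hom = median P m + coarse_median mu K H0
  for P :: "'b set" and m and mu :: "'a::metric_space \<Rightarrow> 'a \<Rightarrow> 'a \<Rightarrow> 'a" and K H0 +
  fixes lam :: "'b \<Rightarrow> 'a" and h :: real
  assumes quasi_hom: "quasi_hom P m mu lam h"
begin

lemma dist_lam_median_le:
  "\<lbrakk>x \<in> P; y \<in> P; z \<in> P\<rbrakk> \<Longrightarrow> dist (lam (m x y z)) (mu (lam x) (lam y) (lam z)) \<le> h"
  using quasi_hom unfolding quasi_hom_def by blast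

definition shadows :: "'b \<Rightarrow> 'a \<Rightarrow> real \<Rightarrow> bool" where
  "shadows u a r \<longleftrightarrow> u \<in> P \<and> dist (lam u) a \<le> r"

lemma dist_le_if_shadows: "\<lbrakk>shadows u a r; shadows u b s\<rbrakk> \<Longrightarrow> dist a b \<le> r + s"
  using dist_triangle3[of a b "lam u"] by (auto simp: shadows_def)

lemma shadows_median:
  assumes "shadows u a r" "shadows v b s" "shadows w c t"
  shows "shadows (m u v w) (mu a b c) (h + \<rho> (r + s + t))"
  using assms dist_lam_median_le[of u v w] dist_mu_le[of "lam u" a r "lam v" b s "lam w" c t]
    dist_triangle[of "lam (m u v w)" "mu a b c" "mu (lam u) (lam v) (lam w)"]
  by (auto simp: shadows_def)

lemma dist_interval_idem_le:
  assumes a: "shadows u a h" and b: "shadows v b h" and c: "shadows w c h"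
  shows "dist (mu a (mu a c b) b) (mu a c b) \<le>
    (h + \<rho> (h + (h + \<rho> (h + h + h)) + h)) + (h + \<rho> (h + h + h))"
proof (rule dist_le_if_shadows)
  show "shadows (m u w v) (mu a c b) (h + \<rho> (h + h + h))"
    using shadows_median[OF a c b] .
  moreover have "m u (m u w v) v = m u w v"
    using a b c median_between(2) by (simp add: shadows_def between_def)
  ultimately show "shadows (m u w v) (mu a (mu a c b) b) (h + \<rho> (h + (h + \<rho> (h + h + h)) + h))"
    using shadows_median[OF a _ b] by metis
qed

lemma interval_split_if_rank_le_1:
  assumes rank: "median_rank_le P m 1"
    and a: "shadows u a h" and b: "shadows v b h" and x: "shadows s x h" and y: "shadows t y h"
  defines "E \<equiv> h + \<rho> (h + h + h)"
  shows "mu a y b \<in> nbhd (E + (h + \<rho> (h + E + E))) (cm_interval mu a (mu a x b)) \<union>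
    nbhd (E + (h + \<rho> (h + E + E))) (cm_interval mu (mu a x b) b)"
proof -
  have P: "u \<in> P" "v \<in> P" "s \<in> P" "t \<in> P"
    using a b x y by (simp_all add: shadows_def)
  have X: "shadows (m u s v) (mu a x b) E" and Y: "shadows (m u t v) (mu a y b) E"
    unfolding E_def using shadows_median a b x y by blast+
  have "between u (m u s v) v" "between u (m u t v) v"
    using median_between(2) P by simp_all
  then consider (first_half) "between u (m u t v) (m u s v)"
    | (second_half) "between (m u s v) (m u t v) v"
    using between_split_if_rank_le_1[OF rank] by blast
  then show ?thesis
  proof cases
    case first_half
    then have "shadows (m u t v) (mu a (mu a y b) (mu a x b)) (h + \<rho> (h + E + E))"
      using shadows_median[OF a Y X] by (simp add: between_def)
    then show ?thesis
      using dist_le_if_shadows[OF Y] unfolding nbhd_def cm_interval_def by blast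
  next
    case second_half
    then have "shadows (m u t v) (mu (mu a x b) (mu a y b) b) (h + \<rho> (E + E + h))"
      using shadows_median[OF X Y b] by (simp add: between_def)
    then have "shadows (m u t v) (mu (mu a x b) (mu a y b) b) (h + \<rho> (h + E + E))"
      by (simp add: algebra_simps)
    then show ?thesis
      using dist_le_if_shadows[OF Y] unfolding nbhd_def cm_interval_def by blast
  qed
qed

lemma coarse_square_image:
  assumes "square p x q y"
  shows "coarse_square mu h (lam p) (lam x) (lam q) (lam y)"
  using assms dist_lam_median_le unfolding square_def between_def coarse_square_def by metis

lemma edge_length_le:
  assumes e: "edge u v" and "s \<in> P - side u v" "t \<in> side u v" and "dist (lam s) (lam t) \<le> r"
  shows "dist (lam u) (lam v) \<le> h + \<rho> r + h"
proof -
  have P: "u \<in> P" "v \<in> P" "s \<in> P" "t \<in> P" and "m u v s = u" "m u v t = v"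
    using assms edge_median_cases[OF e, of s] by (auto simp: edge_def side_def)
  then have "dist (lam u) (mu (lam u) (lam v) (lam s)) \<le> h"
    "dist (lam v) (mu (lam u) (lam v) (lam t)) \<le> h"
    using dist_lam_median_le by metis+
  moreover have "dist (mu (lam u) (lam v) (lam s)) (mu (lam u) (lam v) (lam t)) \<le> \<rho> (0 + 0 + r)"
    using assms(4) by (intro dist_mu_le) simp_all
  ultimately show ?thesis
    using dist_triangle[of "lam u" "lam v" "mu (lam u) (lam v) (lam s)"]
      dist_triangle[of "mu (lam u) (lam v) (lam s)" "lam v" "mu (lam u) (lam v) (lam t)"]
    by (simp add: dist_commute)
qed

lemma crossing_edges_short:
  assumes thin: "thin_intervals mu l" and idem: "idempotent_intervals mu C"
    and e: "edge u v" and e': "edge u' v'" and cross: "crossing P (side u v) (side u' v')"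
  defines "L \<equiv> h + \<rho> (coarse_square_bound l C h) + h"
  shows "dist (lam u) (lam v) \<le> L \<or> dist (lam u') (lam v') \<le> L"
proof -
  obtain p x q y where sq: "square p x q y"
    and corners: "p \<notin> side u v \<union> side u' v'" "x \<in> side u v - side u' v'"
      "q \<in> side u v \<inter> side u' v'" "y \<in> side u' v' - side u v"
    using square_if_crossing[OF halfspace_side[OF e] halfspace_side[OF e'] cross] by blast
  have P: "p \<in> P" "y \<in> P"
    using sq by (simp_all add: square_def between_def)
  consider (short_yp) "dist (lam y) (lam p) \<le> coarse_square_bound l C h"
    | (short_yq) "dist (lam y) (lam q) \<le> coarse_square_bound l C h"
    using thin_coarse_square[OF thin idem coarse_square_image[OF sq]] by blast
  then show ?thesis
  proof cases
    case short_yp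
    then show ?thesis
      using edge_length_le[OF e', of p y] corners P by (simp add: L_def dist_commute)
  next
    case short_yq
    then show ?thesis
      using edge_length_le[OF e, of y q] corners P by (simp add: L_def)
  qed
qed

end

section \<open>Rank one and thin intervals\<close>

context coarse_median
begin

lemma median_quasi_hom_if_approximates:
  assumes "approximates mu A P m \<pi> lam h"
  shows "median_quasi_hom P m mu K H0 lam h"
  using assms by unfold_locales (simp_all add: approximates_def)

lemma shadows_if_approximates:
  assumes "approximates mu A P m \<pi> lam h" "a \<in> A"
  shows "median_quasi_hom.shadows P lam (\<pi> a) a h"
  using assms median_quasi_hom.shadows_def[OF median_quasi_hom_if_approximates[OF assms(1)]]
  by (auto simp: approximates_def)

lemma thin_intervals_if_rank_le_1:
  assumes C2: "cm_C2 mu H (\<lambda>P m. median_rank_le P m 1)"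
  obtains l where "thin_intervals mu l"
proof -
  define E where "E = H 4 + \<rho> (H 4 + H 4 + H 4)"
  define l where "l = E + (H 4 + \<rho> (H 4 + E + E))"
  have "mu a y b \<in> nbhd l (cm_interval mu a (mu a x b)) \<union> nbhd l (cm_interval mu (mu a x b) b)"
    for a b x y
  proof -
    obtain P :: "nat set" and m \<pi> lam
      where approx: "approximates mu (set [a, b, x, y]) P m \<pi> lam (H 4)"
      and rank: "median_rank_le P m 1"
      by (rule approximation_of_list[OF C2, of "[a, b, x, y]" 4]) auto
    interpret median_quasi_hom P m mu K H0 lam "H 4"
      using median_quasi_hom_if_approximates[OF approx] .
    show ?thesis
      unfolding l_def E_def
      by (rule interval_split_if_rank_le_1[OF rank]; rule shadows_if_approximates[OF approx]) auto
  qed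
  then have "thin_intervals mu l"
    unfolding thin_intervals_def cm_interval_def by blast
  then show thesis
    using that by blast
qed

lemma idempotent_intervals_if_cm_C2:
  assumes C2: "cm_C2 mu H Q"
  obtains C where "idempotent_intervals mu C"
proof -
  define E where "E = H 3 + \<rho> (H 3 + H 3 + H 3)"
  have "dist (mu a (mu a c b) b) (mu a c b) \<le> (H 3 + \<rho> (H 3 + E + H 3)) + E" for a b c
  proof -
    obtain P :: "nat set" and m \<pi> lam
      where approx: "approximates mu (set [a, b, c]) P m \<pi> lam (H 3)"
      by (rule approximation_of_list[OF C2, of "[a, b, c]" 3]) auto
    interpret median_quasi_hom P m mu K H0 lam "H 3"
      using median_quasi_hom_if_approximates[OF approx] .
    show ?thesis
      unfolding E_def by (rule dist_interval_idem_le; rule shadows_if_approximates[OF approx]) auto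
  qed
  then show thesis
    using that unfolding idempotent_intervals_def by blast
qed

definition collapse_bound :: "real \<Rightarrow> real \<Rightarrow> real \<Rightarrow> real" where
  "collapse_bound l C h = max 0 (h + \<rho> (coarse_square_bound l C h) + h)"

lemma rank_one_approximation_if_thin:
  assumes thin: "thin_intervals mu l" and idem: "idempotent_intervals mu C"
    and "finite A" and approx: "approximates mu A P\<^sub>0 m \<pi> lam h"
  obtains P m' \<pi>' where "approximates mu A P m' \<pi>' lam (h + collapse_bound l C h * 2 ^ card A)"
    "median_rank_le P m' 1"
proof -
  define P where "P = median_closed m hull (\<pi> ` A)"
  have approx_P: "approximates mu A P m \<pi> lam h"
    using approximates_generated[OF approx] by (simp add: P_def)
  then have P: "finite P" "\<And>a. a \<in> A \<Longrightarrow> \<pi> a \<in> P" "\<And>a. a \<in> A \<Longrightarrow> dist (lam (\<pi> a)) a \<le> h"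
    by (auto simp: approximates_def)
  interpret median_quasi_hom P m mu K H0 lam h
    using median_quasi_hom_if_approximates[OF approx_P] .
  let ?L = "collapse_bound l C h" and ?h = "h + collapse_bound l C h * 2 ^ card A"
  have "?L \<ge> 0"
    by (simp add: collapse_bound_def)
  have short: "dist (lam u) (lam v) \<le> ?L \<or> dist (lam u') (lam v') \<le> ?L"
    if "edge u v" "edge u' v'" "crossing P (side u v) (side u' v')" for u v u' v'
    using crossing_edges_short[OF thin idem that] by (auto simp: collapse_bound_def)
  obtain \<sigma> where \<sigma>P: "\<And>x. x \<in> P \<Longrightarrow> \<sigma> x \<in> P"
    and quotient: "median_algebra (\<sigma> ` P) (\<lambda>x y z. \<sigma> (m x y z))"
      "median_rank_le (\<sigma> ` P) (\<lambda>x y z. \<sigma> (m x y z)) 1"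
    and \<sigma>_close: "\<And>x. x \<in> P \<Longrightarrow> dist (lam (\<sigma> x)) (lam x) \<le> ?L * 2 ^ card (\<pi> ` A)"
    using collapse_short_edges[where lam = lam, OF P_def finite_imageI[OF \<open>finite A\<close>] P(1)
      \<open>?L \<ge> 0\<close> short] by blast
  have "?L * 2 ^ card (\<pi> ` A) \<le> ?L * 2 ^ card A"
    using card_image_le[OF \<open>finite A\<close>] \<open>?L \<ge> 0\<close> by (intro mult_left_mono power_increasing) simp_all
  then have near: "dist (lam (\<sigma> x)) c \<le> ?h" if "x \<in> P" "dist (lam x) c \<le> h" for x c
    using that \<sigma>_close[of x] dist_triangle[of "lam (\<sigma> x)" c "lam x"] by linarith
  then have "quasi_hom (\<sigma> ` P) (\<lambda>x y z. \<sigma> (m x y z)) mu lam ?h"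
    using \<sigma>P dist_lam_median_le unfolding quasi_hom_def by auto
  then have "approximates mu A (\<sigma> ` P) (\<lambda>x y z. \<sigma> (m x y z)) (\<sigma> \<circ> \<pi>) lam ?h"
    using quotient(1) P near by (auto simp: approximates_def)
  then show thesis
    using that quotient(2) by blast
qed

lemma rank_le_1_if_thin_intervals:
  assumes thin: "thin_intervals mu l" and C2: "cm_C2 mu H Q"
  shows "cm_rank_le mu 1"
proof -
  obtain C where idem: "idempotent_intervals mu C"
    using idempotent_intervals_if_cm_C2[OF C2] by blast
  define H' where "H' p = H p + collapse_bound l C (H p) * 2 ^ p" for p
  have "\<exists>(P :: nat set) m \<pi> lam. approximates mu A P m \<pi> lam (H' p) \<and> median_rank_le P m 1"
    if A: "finite A \<and> 1 \<le> card A \<and> card A \<le> p" for p and A :: "'a set"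
  proof -
    obtain P :: "nat set" and m \<pi> lam where "approximates mu A P m \<pi> lam (H p)"
      using C2 A unfolding cm_C2_iff_approximates by blast
    then obtain P' :: "nat set" and m' \<pi>' where
      "approximates mu A P' m' \<pi>' lam (H p + collapse_bound l C (H p) * 2 ^ card A)"
      and rank: "median_rank_le P' m' 1"
      using rank_one_approximation_if_thin[OF thin idem] A by blast
    moreover have "collapse_bound l C (H p) * 2 ^ card A \<le> collapse_bound l C (H p) * 2 ^ p"
      using A by (intro mult_left_mono power_increasing) (simp_all add: collapse_bound_def)
    ultimately have "approximates mu A P' m' \<pi>' lam (H' p)"
      by (simp add: approximates_mono H'_def)
    then show ?thesis
      using rank by blast
  qed
  then have "cm_C2 mu H' (\<lambda>P m. median_rank_le P m 1)"
    unfolding cm_C2_iff_approximates by blast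
  then show ?thesis
    using C1 unfolding cm_rank_le_def by blast
qed

end

lemma coarse_median_abs:
  assumes "cm_M2 mu" and C1: "cm_C1 mu K H0"
  shows "coarse_median mu \<bar>K\<bar> H0"
proof
  show "cm_C1 mu \<bar>K\<bar> H0"
    unfolding cm_C1_def
  proof (intro allI)
    fix a b c a' b' c' :: 'a
    let ?d = "dist a a' + dist b b' + dist c c'"
    have "dist (mu a b c) (mu a' b' c') \<le> K * ?d + H0"
      using C1 unfolding cm_C1_def by blast
    also have "\<dots> \<le> \<bar>K\<bar> * ?d + H0"
      by (intro add_right_mono mult_right_mono) auto
    finally show "dist (mu a b c) (mu a' b' c') \<le> \<bar>K\<bar> * ?d + H0" .
  qed
qed (use assms in auto)

theorem theorem4p4:
  fixes mu :: "'a::metric_space \<Rightarrow> 'a \<Rightarrow> 'a \<Rightarrow> 'a"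
  assumes "coarse_median_space mu"
  shows "cm_rank_le mu 1 \<longleftrightarrow>
    (\<exists>l::real. \<forall>a b x. x \<in> cm_interval mu a b \<longrightarrow>
        cm_interval mu a b \<subseteq> nbhd l (cm_interval mu a x) \<union> nbhd l (cm_interval mu x b))"
  unfolding thin_intervals_def[symmetric]
proof
  have M2: "cm_M2 mu"
    using assms by (simp add: coarse_median_space_def)
  show "\<exists>l. thin_intervals mu l" if rank: "cm_rank_le mu 1"
  proof -
    obtain K H0 H where "cm_C1 mu K H0" and C2: "cm_C2 mu H (\<lambda>P m. median_rank_le P m 1)"
      using rank unfolding cm_rank_le_def by blast
    then show ?thesis
      using coarse_median.thin_intervals_if_rank_le_1[OF coarse_median_abs C2] M2 by blast
  qed
  show "cm_rank_le mu 1" if thin: "\<exists>l. thin_intervals mu l"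
  proof -
    obtain K H0 H where "cm_C1 mu K H0" and C2: "cm_C2 mu H (\<lambda>_ _. True)"
      using assms unfolding coarse_median_space_def by blast
    then show ?thesis
      using coarse_median.rank_le_1_if_thin_intervals[OF coarse_median_abs _ C2] M2 thin by blast
  qed
qed

end
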